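(* Let $m$ be a positive odd integer whose root $a$ (defined by $m = 2a+1$) is odd. Let $x$ be the largest exponent such that $2^x$ divides $3m+1$. Then $$\frac{3m+1}{2^x} > m.$$
   Context: For a positive odd integer $m$, the root of $m$ is the integer $a \ge 0$ with $m = 2a+1$. The reduced Collatz iteration sends a positive odd integer $m$ to $R(m) = \frac{3m+1}{2^x}$, where $2^x$ is the highest power of $2$ dividing $3m+1$. *)

theory Defs
  imports Complex_Main "HOL-Computational_Algebra.Primes"
begin

end

theory Submission
  imports Defs
begin

text \<open>An odd root means m is 3 mod 4, so 3m + 1 is 2 mod 4: exactly one factor 2 can be
  removed. Halving leaves (3m + 1) / 2, which exceeds m because m is positive.\<close>

theorem theorem1:
  fixes m a :: int and x :: nat
  assumes "m > 0" and "odd m"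
    and "a \<ge> 0" and "m = 2 * a + 1" and "odd a"
    and "x = multiplicity 2 (3 * m + 1)"
  shows "real_of_int (3 * m + 1) / 2 ^ x > real_of_int m"
proof -
  obtain b where "a = 2 * b + 1"
    using \<open>odd a\<close> by (rule oddE)
  then have eq: "3 * m + 1 = 2 * (6 * b + 5)"
    using \<open>m = 2 * a + 1\<close> by simp
  \<comment> \<open>The cofactor 6b + 5 is odd, so 4 does not divide 3m + 1. The power is written
    \<open>2 ^ Suc 1\<close> to match the premise of \<open>multiplicity_eqI\<close>.\<close>
  then have "\<not> 2 ^ Suc 1 dvd 3 * m + 1"
    by simp presburger
  then have "multiplicity 2 (3 * m + 1) = 1"
    by (intro multiplicity_eqI) (simp_all add: eq)
  then have "x = 1"
    using \<open>x = multiplicity 2 (3 * m + 1)\<close> by simp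
  then show ?thesis
    using \<open>m > 0\<close> by simp
qed

end
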